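(* Let $X$ be a simply connected, locally path connected Hausdorff space, let $G$ be a compact Hausdorff group, let $\Gamma$ be a discrete group acting on $X$ from the left freely and properly discontinuously, and let $\phi:\Gamma\to G$ be a group morphism such that the composition $\Gamma\xrightarrow{\phi}G\to\pi_0(G)$ is a group monomorphism. Let $\Gamma$ act on $X\times G$ by $\gamma\cdot(x,g)=(\gamma x,\phi(\gamma)g)$, and let $E:=\Gamma\backslash(X\times G)$ with the right $G$-action induced by right translation on the $G$ factor, regarded as a principal $G$-bundle over $Y:=\Gamma\backslash X$. Then the bundle $E\to Y$ is incompressible.
   Context: The action of $\Gamma$ on $X$ is properly discontinuous if every point of $X$ has an open neighbourhood $U$ with $\gamma U\cap U=\emptyset$ for all $\gamma\in\Gamma$, $\gamma\neq1$. $G_a$ denotes the normal subgroup of $G$ of elements joined to the identity by a continuous path in $G$, and $\pi_0(G):=G/G_a$ as an abstract group. The projection $E\to Y$ is induced by the first projection $X\times G\to X$. A principal $G$-bundle over $Y$ is incompressible if its restriction (pullback) to every non-nullhomotopic loop in $Y$ is a non-trivial bundle (over the circle). *)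

theory Defs
  imports "HOL-Analysis.Analysis" "HOL-Algebra.Group_Action"
begin

definition topological_group :: "('g, 'm) monoid_scheme \<Rightarrow> 'g topology \<Rightarrow> bool" where
  "topological_group G T \<longleftrightarrow>
     group G \<and> topspace T = carrier G \<and>
     continuous_map (prod_topology T T) T (\<lambda>(g, h). g \<otimes>\<^bsub>G\<^esub> h) \<and>
     continuous_map T T (\<lambda>g. inv\<^bsub>G\<^esub> g)"

definition identity_path_component :: "('g, 'm) monoid_scheme \<Rightarrow> 'g topology \<Rightarrow> 'g set" where
  "identity_path_component G T = {g \<in> carrier G. path_component_of T \<one>\<^bsub>G\<^esub> g}"

text \<open>Loops are maps from the unit circle; null-homotopy is free homotopy to a constant map,
  which for maps from the circle is the same as null-homotopy relative to a base point.\<close>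

definition circle :: "complex topology" where
  "circle = top_of_set (sphere 0 1)"

definition nullhomotopic_loop :: "'a topology \<Rightarrow> (complex \<Rightarrow> 'a) \<Rightarrow> bool" where
  "nullhomotopic_loop X l \<longleftrightarrow> (\<exists>c. homotopic_with (\<lambda>_. True) circle X l (\<lambda>_. c))"

definition simply_connected_space :: "'a topology \<Rightarrow> bool" where
  "simply_connected_space X \<longleftrightarrow>
     path_connected_space X \<and> (\<forall>l. continuous_map circle X l \<longrightarrow> nullhomotopic_loop X l)"

definition quotient_topology :: "'a topology \<Rightarrow> ('a \<Rightarrow> 'b) \<Rightarrow> 'b topology" where
  "quotient_topology X q =
     topology (\<lambda>U. U \<subseteq> q ` topspace X \<and> openin X {x \<in> topspace X. q x \<in> U})"

lemma istopology_quotient: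
  "istopology (\<lambda>U. U \<subseteq> q ` topspace X \<and> openin X {x \<in> topspace X. q x \<in> U})"
proof -
  have 1: "{x \<in> topspace X. q x \<in> S \<inter> T} = {x \<in> topspace X. q x \<in> S} \<inter> {x \<in> topspace X. q x \<in> T}"
    for S T by auto
  have 2: "{x \<in> topspace X. q x \<in> \<Union>\<K>} = (\<Union>K\<in>\<K>. {x \<in> topspace X. q x \<in> K})" for \<K>
    by auto
  show ?thesis
    unfolding istopology_def 1 2 by blast
qed

lemma openin_quotient_topology:
  "openin (quotient_topology X q) U \<longleftrightarrow>
     U \<subseteq> q ` topspace X \<and> openin X {x \<in> topspace X. q x \<in> U}"
  unfolding quotient_topology_def by (simp add: istopology_quotient topology_inverse')

definition continuous_action :: "('c, 'n) monoid_scheme \<Rightarrow> 'a topology \<Rightarrow> ('c \<Rightarrow> 'a \<Rightarrow> 'a) \<Rightarrow> bool" where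
  "continuous_action \<Gamma> X act \<longleftrightarrow>
     group_action \<Gamma> (topspace X) act \<and> (\<forall>\<gamma>\<in>carrier \<Gamma>. continuous_map X X (act \<gamma>))"

definition free_action :: "('c, 'n) monoid_scheme \<Rightarrow> 'a topology \<Rightarrow> ('c \<Rightarrow> 'a \<Rightarrow> 'a) \<Rightarrow> bool" where
  "free_action \<Gamma> X act \<longleftrightarrow>
     (\<forall>\<gamma>\<in>carrier \<Gamma>. \<forall>x\<in>topspace X. act \<gamma> x = x \<longrightarrow> \<gamma> = \<one>\<^bsub>\<Gamma>\<^esub>)"

definition properly_discontinuous ::
  "('c, 'n) monoid_scheme \<Rightarrow> 'a topology \<Rightarrow> ('c \<Rightarrow> 'a \<Rightarrow> 'a) \<Rightarrow> bool" where
  "properly_discontinuous \<Gamma> X act \<longleftrightarrow>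
     (\<forall>x\<in>topspace X. \<exists>U. openin X U \<and> x \<in> U \<and>
        (\<forall>\<gamma>\<in>carrier \<Gamma>. \<gamma> \<noteq> \<one>\<^bsub>\<Gamma>\<^esub> \<longrightarrow> act \<gamma> ` U \<inter> U = {}))"

definition orbit_space ::
  "('c, 'n) monoid_scheme \<Rightarrow> 'a topology \<Rightarrow> ('c \<Rightarrow> 'a \<Rightarrow> 'a) \<Rightarrow> 'a set topology" where
  "orbit_space \<Gamma> X act = quotient_topology X (orbit \<Gamma> act)"

record ('e, 'b, 'g) gbundle =
  total_space :: "'e topology"
  base_space :: "'b topology"
  proj :: "'e \<Rightarrow> 'b"
  ract :: "'e \<Rightarrow> 'g \<Rightarrow> 'e"

definition restrict_bundle :: "('e, 'b, 'g) gbundle \<Rightarrow> 'b set \<Rightarrow> ('e, 'b, 'g) gbundle" where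
  "restrict_bundle P U =
     \<lparr>total_space = subtopology (total_space P) {e. proj P e \<in> U}, base_space = subtopology (base_space P) U,
      proj = proj P, ract = ract P\<rparr>"

definition pullback_bundle ::
  "'a topology \<Rightarrow> ('a \<Rightarrow> 'b) \<Rightarrow> ('e, 'b, 'g) gbundle \<Rightarrow> ('a \<times> 'e, 'a, 'g) gbundle" where
  "pullback_bundle A f P =
     \<lparr>total_space = subtopology (prod_topology A (total_space P)) {(a, e). f a = proj P e}, base_space = A,
      proj = fst, ract = (\<lambda>(a, e) g. (a, ract P e g))\<rparr>"

text \<open>Isomorphism over the base with the product bundle, on which the group acts by right
  translation of the second factor.\<close>

definition trivial_bundle ::
  "('g, 'm) monoid_scheme \<Rightarrow> 'g topology \<Rightarrow> ('e, 'b, 'g) gbundle \<Rightarrow> bool" where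
  "trivial_bundle G T P \<longleftrightarrow>
     (\<exists>h. homeomorphic_map (total_space P) (prod_topology (base_space P) T) h \<and>
          (\<forall>e\<in>topspace (total_space P). fst (h e) = proj P e) \<and>
          (\<forall>e\<in>topspace (total_space P). \<forall>g\<in>carrier G.
             h (ract P e g) = (fst (h e), snd (h e) \<otimes>\<^bsub>G\<^esub> g)))"

definition principal_bundle ::
  "('g, 'm) monoid_scheme \<Rightarrow> 'g topology \<Rightarrow> ('e, 'b, 'g) gbundle \<Rightarrow> bool" where
  "principal_bundle G T P \<longleftrightarrow>
     topological_group G T \<and>
     continuous_map (total_space P) (base_space P) (proj P) \<and>
     continuous_map (prod_topology (total_space P) T) (total_space P) (\<lambda>(e, g). ract P e g) \<and>
     (\<forall>e\<in>topspace (total_space P). ract P e \<one>\<^bsub>G\<^esub> = e) \<and>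
     (\<forall>e\<in>topspace (total_space P). \<forall>g\<in>carrier G. \<forall>h\<in>carrier G.
        ract P (ract P e g) h = ract P e (g \<otimes>\<^bsub>G\<^esub> h)) \<and>
     (\<forall>e\<in>topspace (total_space P). \<forall>g\<in>carrier G. proj P (ract P e g) = proj P e) \<and>
     (\<forall>b\<in>topspace (base_space P). \<exists>U. openin (base_space P) U \<and> b \<in> U \<and>
        trivial_bundle G T (restrict_bundle P U))"

definition incompressible ::
  "('g, 'm) monoid_scheme \<Rightarrow> 'g topology \<Rightarrow> ('e, 'b, 'g) gbundle \<Rightarrow> bool" where
  "incompressible G T P \<longleftrightarrow>
     principal_bundle G T P \<and>
     (\<forall>l. continuous_map circle (base_space P) l \<and> \<not> nullhomotopic_loop (base_space P) l \<longrightarrow>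
        \<not> trivial_bundle G T (pullback_bundle circle l P))"

text \<open>The restriction to the carrier makes this an action in the sense of
  \<^const>\<open>group_action\<close>, whose values are extensional bijections.\<close>

definition diagonal_action ::
  "'a topology \<Rightarrow> ('g, 'm) monoid_scheme \<Rightarrow> ('c \<Rightarrow> 'a \<Rightarrow> 'a) \<Rightarrow> ('c \<Rightarrow> 'g) \<Rightarrow> 'c \<Rightarrow> 'a \<times> 'g \<Rightarrow> 'a \<times> 'g" where
  "diagonal_action X G act \<phi> \<gamma> =
     (\<lambda>(x, g)\<in>topspace X \<times> carrier G. (act \<gamma> x, \<phi> \<gamma> \<otimes>\<^bsub>G\<^esub> g))"

text \<open>Points of the orbit spaces are orbits. The first projection and the right translations of
  the product are equivariant, resp. commute with the action, so the induced maps on orbits are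
  given by taking images.\<close>

definition associated_bundle ::
  "('c, 'n) monoid_scheme \<Rightarrow> 'a topology \<Rightarrow> ('c \<Rightarrow> 'a \<Rightarrow> 'a) \<Rightarrow>
   ('g, 'm) monoid_scheme \<Rightarrow> 'g topology \<Rightarrow> ('c \<Rightarrow> 'g) \<Rightarrow> (('a \<times> 'g) set, 'a set, 'g) gbundle" where
  "associated_bundle \<Gamma> X act G T \<phi> =
     \<lparr>total_space = orbit_space \<Gamma> (prod_topology X T) (diagonal_action X G act \<phi>),
      base_space = orbit_space \<Gamma> X act,
      proj = (\<lambda>e. fst ` e),
      ract = (\<lambda>e h. (\<lambda>(x, g). (x, g \<otimes>\<^bsub>G\<^esub> h)) ` e)\<rparr>"

end

theory Submission
  imports Defs
begin

text \<open>
  A trivialization of the pullback of \<open>E\<close> along a loop \<open>l\<close> gives a section of \<open>E\<close> over \<open>l\<close>.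
  Since \<open>\<Gamma>\<close> acts properly discontinuously on \<open>X \<times> G\<close> as well, this section, read as a path in \<open>E\<close>,
  lifts to a path \<open>(x(t), g(t))\<close> in \<open>X \<times> G\<close> whose end points differ by some \<open>\<gamma>\<close> in \<open>\<Gamma>\<close>.
  Then \<open>g\<close> joins \<open>g(0)\<close> to \<open>\<phi>(\<gamma>) g(0)\<close>, so \<open>\<phi>(\<gamma>)\<close> lies in the path component of the identity
  and \<open>\<gamma> = 1\<close> by injectivity on \<open>\<pi>\<^sub>0\<close>. Hence \<open>x\<close> is a loop in the simply connected space \<open>X\<close>
  that covers \<open>l\<close>, and \<open>l\<close> is null-homotopic.
\<close>

section \<open>The quotient topology\<close>

lemma topspace_quotient_topology [simp]: "topspace (quotient_topology X q) = q ` topspace X"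
proof -
  have "{x \<in> topspace X. q x \<in> q ` topspace X} = topspace X"
    by auto
  then have "openin (quotient_topology X q) (q ` topspace X)"
    by (simp add: openin_quotient_topology)
  then show ?thesis
    by (meson openin_quotient_topology openin_subset openin_topspace subset_antisym)
qed

lemma quotient_map_quotient_topology: "quotient_map X (quotient_topology X q) q"
  by (auto simp: quotient_map_def openin_quotient_topology)

section \<open>Orbit maps of properly discontinuous actions\<close>

locale properly_discontinuous_action =
  fixes \<Gamma> :: "('c, 'n) monoid_scheme" and X :: "'a topology" and act :: "'c \<Rightarrow> 'a \<Rightarrow> 'a"
  assumes cont_act: "continuous_action \<Gamma> X act"
    and prop_disc: "properly_discontinuous \<Gamma> X act"
begin

sublocale group_action \<Gamma> "topspace X" act
  using cont_act by (simp add: continuous_action_def)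

sublocale group \<Gamma>
  using group_hom group_hom.axioms(1) by blast

lemma continuous_map_act: "\<gamma> \<in> carrier \<Gamma> \<Longrightarrow> continuous_map X X (act \<gamma>)"
  using cont_act by (simp add: continuous_action_def)

lemma act_one: "x \<in> topspace X \<Longrightarrow> act \<one>\<^bsub>\<Gamma>\<^esub> x = x"
  using id_eq_one by (metis restrict_apply')

lemma act_closed: "\<gamma> \<in> carrier \<Gamma> \<Longrightarrow> x \<in> topspace X \<Longrightarrow> act \<gamma> x \<in> topspace X"
  using element_image by blast

lemma orbit_eq_iff:
  assumes "x \<in> topspace X" "y \<in> topspace X"
  shows "orbit \<Gamma> act x = orbit \<Gamma> act y \<longleftrightarrow> (\<exists>\<gamma>\<in>carrier \<Gamma>. y = act \<gamma> x)"
proof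
  assume "orbit \<Gamma> act x = orbit \<Gamma> act y"
  then have "y \<in> orbit \<Gamma> act x"
    using orbit_refl assms by simp
  then show "\<exists>\<gamma>\<in>carrier \<Gamma>. y = act \<gamma> x"
    by (auto simp: orbit_def)
next
  assume "\<exists>\<gamma>\<in>carrier \<Gamma>. y = act \<gamma> x"
  then have y: "y \<in> orbit \<Gamma> act x"
    by (auto simp: orbit_def)
  have sub: "orbit \<Gamma> act z \<subseteq> topspace X" if "z \<in> topspace X" for z
    using that act_closed by (auto simp: orbit_def)
  show "orbit \<Gamma> act x = orbit \<Gamma> act y"
    using orbit_trans orbit_sym assms y sub by blast
qed

lemma orbit_act: "\<gamma> \<in> carrier \<Gamma> \<Longrightarrow> x \<in> topspace X \<Longrightarrow> orbit \<Gamma> act (act \<gamma> x) = orbit \<Gamma> act x"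
  using act_closed orbit_eq_iff by metis

lemma topspace_orbit_space [simp]: "topspace (orbit_space \<Gamma> X act) = orbit \<Gamma> act ` topspace X"
  by (simp add: orbit_space_def)

lemma quotient_map_orbit: "quotient_map X (orbit_space \<Gamma> X act) (orbit \<Gamma> act)"
  by (simp add: orbit_space_def quotient_map_quotient_topology)

lemma continuous_map_orbit: "continuous_map X (orbit_space \<Gamma> X act) (orbit \<Gamma> act)"
  by (simp add: quotient_imp_continuous_map quotient_map_orbit)

text \<open>The saturation of an open set is the union of its preimages under the continuous maps
  \<open>act \<gamma>\<close>, hence open.\<close>

lemma open_map_orbit: "open_map X (orbit_space \<Gamma> X act) (orbit \<Gamma> act)"
  unfolding open_map_def
proof (intro allI impI)
  fix U assume U: "openin X U"
  then have UX: "U \<subseteq> topspace X"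
    by (rule openin_subset)
  have "{x \<in> topspace X. orbit \<Gamma> act x \<in> orbit \<Gamma> act ` U}
      = (\<Union>\<gamma>\<in>carrier \<Gamma>. {x \<in> topspace X. act \<gamma> x \<in> U})" (is "?L = ?R")
  proof
    show "?L \<subseteq> ?R"
      using UX orbit_eq_iff by (clarsimp simp: image_iff) (metis subsetD)
    show "?R \<subseteq> ?L"
      using orbit_act by (auto simp: image_iff)
  qed
  moreover have "openin X {x \<in> topspace X. act \<gamma> x \<in> U}" if "\<gamma> \<in> carrier \<Gamma>" for \<gamma>
    using continuous_map_act[OF that] U by (rule openin_continuous_map_preimage)
  ultimately show "openin (orbit_space \<Gamma> X act) (orbit \<Gamma> act ` U)"
    using UX by (auto simp: orbit_space_def openin_quotient_topology)
qed

text \<open>The orbit map is continuous and open, so only injectivity on \<open>U\<close> is at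
  stake. Two points of \<open>U\<close> in one orbit differ by some \<gamma> whose translate of
  \<open>U\<close> meets \<open>U\<close>, and \<open>disj\<close> forces this \<gamma> to be the
  identity.\<close>

lemma homeomorphic_map_orbit:
  assumes U: "openin X U"
    and disj: "\<And>\<gamma>. \<gamma> \<in> carrier \<Gamma> \<Longrightarrow> \<gamma> \<noteq> \<one>\<^bsub>\<Gamma>\<^esub> \<Longrightarrow> act \<gamma> ` U \<inter> U = {}"
  shows "homeomorphic_map (subtopology X U)
           (subtopology (orbit_space \<Gamma> X act) (orbit \<Gamma> act ` U)) (orbit \<Gamma> act)"
proof (rule bijective_open_imp_homeomorphic_map)
  have UX: "U \<subseteq> topspace X"
    using U by (rule openin_subset)
  show "continuous_map (subtopology X U) (subtopology (orbit_space \<Gamma> X act) (orbit \<Gamma> act ` U)) (orbit \<Gamma> act)"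
    using continuous_map_orbit by (auto simp: continuous_map_in_subtopology continuous_map_from_subtopology)
  show "open_map (subtopology X U) (subtopology (orbit_space \<Gamma> X act) (orbit \<Gamma> act ` U)) (orbit \<Gamma> act)"
    by (intro open_map_into_subtopology open_map_from_subtopology open_map_orbit U) auto
  show "orbit \<Gamma> act ` topspace (subtopology X U)
      = topspace (subtopology (orbit_space \<Gamma> X act) (orbit \<Gamma> act ` U))"
    using UX by auto
  show "inj_on (orbit \<Gamma> act) (topspace (subtopology X U))"
  proof (rule inj_onI)
    fix x y assume "x \<in> topspace (subtopology X U)" "y \<in> topspace (subtopology X U)"
      and eq: "orbit \<Gamma> act x = orbit \<Gamma> act y"
    then have xy: "x \<in> U" "y \<in> U" "x \<in> topspace X" "y \<in> topspace X"
      by auto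
    then obtain \<gamma> where \<gamma>: "\<gamma> \<in> carrier \<Gamma>" "y = act \<gamma> x"
      using eq orbit_eq_iff by blast
    with xy disj[of \<gamma>] have "\<gamma> = \<one>\<^bsub>\<Gamma>\<^esub>"
      by blast
    with \<gamma> xy show "x = y"
      by (simp add: act_one)
  qed
qed

section \<open>Path lifting along the orbit map\<close>

text \<open>The start point \<open>z\<close> is arbitrary in the fibre over \<open>p a\<close>, so
  that a lift over the next interval can start where the previous one ends.\<close>

definition lifts_on :: "(real \<Rightarrow> 'a set) \<Rightarrow> real \<Rightarrow> real \<Rightarrow> bool" where
  "lifts_on p a b \<longleftrightarrow>
     (\<forall>z\<in>topspace X. orbit \<Gamma> act z = p a \<longrightarrow>
        (\<exists>f. continuous_map (top_of_set {a..b}) X f \<and> f a = z \<and> (\<forall>t\<in>{a..b}. orbit \<Gamma> act (f t) = p t)))"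

lemma lifts_on_trans:
  assumes ab: "lifts_on p a b" and bc: "lifts_on p b c" and le: "a \<le> b" "b \<le> c"
  shows "lifts_on p a c"
  unfolding lifts_on_def
proof (intro ballI impI)
  fix z assume "z \<in> topspace X" "orbit \<Gamma> act z = p a"
  then obtain f where f: "continuous_map (top_of_set {a..b}) X f" "f a = z"
      "\<forall>t\<in>{a..b}. orbit \<Gamma> act (f t) = p t"
    using ab unfolding lifts_on_def by blast
  have "f b \<in> topspace X" "orbit \<Gamma> act (f b) = p b"
    using f le by (auto simp: continuous_map_def)
  then obtain g where g: "continuous_map (top_of_set {b..c}) X g" "g b = f b"
      "\<forall>t\<in>{b..c}. orbit \<Gamma> act (g t) = p t"
    using bc unfolding lifts_on_def by blast
  let ?h = "\<lambda>t. if t \<le> b then f t else g t"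
  have "continuous_map (top_of_set {a..c}) X ?h"
  proof (rule continuous_map_cases_le)
    have "{a..c} \<inter> {x \<in> {a..c}. x \<le> b} = {a..b}" "{a..c} \<inter> {x \<in> {a..c}. b \<le> x} = {b..c}"
      using le by auto
    then show "continuous_map (subtopology (top_of_set {a..c}) {x \<in> topspace (top_of_set {a..c}). x \<le> b}) X f"
      "continuous_map (subtopology (top_of_set {a..c}) {x \<in> topspace (top_of_set {a..c}). b \<le> x}) X g"
      using f(1) g(1) by (simp_all add: subtopology_subtopology)
  qed (use g in auto)
  then show "\<exists>h. continuous_map (top_of_set {a..c}) X h \<and> h a = z \<and> (\<forall>t\<in>{a..c}. orbit \<Gamma> act (h t) = p t)"
    using f g le by (intro exI[of _ ?h]) auto
qed

text \<open>On the image of \<open>U\<close> the orbit map has a continuous inverse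
  \<open>s\<close>, so \<open>s \<circ> p\<close> is a lift; a translate of it by an element of
  \<Gamma> starts at the prescribed point.\<close>

lemma lifts_on_local:
  assumes p: "continuous_map (top_of_set {a..b}) (orbit_space \<Gamma> X act) p"
    and U: "openin X U" 
    and disj: "\<And>\<gamma>. \<gamma> \<in> carrier \<Gamma> \<Longrightarrow> \<gamma> \<noteq> \<one>\<^bsub>\<Gamma>\<^esub> \<Longrightarrow> act \<gamma> ` U \<inter> U = {}"
    and pU: "p ` {a..b} \<subseteq> orbit \<Gamma> act ` U" and le: "a \<le> b"
  shows "lifts_on p a b"
  unfolding lifts_on_def
proof (intro ballI impI)
  fix z assume z: "z \<in> topspace X" "orbit \<Gamma> act z = p a"
  have UX: "U \<subseteq> topspace X"
    using U by (rule openin_subset)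
  let ?V = "orbit \<Gamma> act ` U"
  obtain s where s: "homeomorphic_maps (subtopology X U) (subtopology (orbit_space \<Gamma> X act) ?V) (orbit \<Gamma> act) s"
    using homeomorphic_map_orbit[OF U disj] homeomorphic_map_maps by blast
  then have cs: "continuous_map (subtopology (orbit_space \<Gamma> X act) ?V) (subtopology X U) s"
    and os: "\<And>v. v \<in> ?V \<Longrightarrow> orbit \<Gamma> act (s v) = v"
    using UX by (auto simp: homeomorphic_maps_def)
  have sU: "s v \<in> U" if "v \<in> ?V" for v
    using cs that UX by (auto simp: continuous_map_def Pi_iff)
  have pa: "p a \<in> ?V"
    using pU le by auto
  then obtain \<gamma> where \<gamma>: "\<gamma> \<in> carrier \<Gamma>" "z = act \<gamma> (s (p a))"
    using orbit_eq_iff[of "s (p a)" z] z os[OF pa] sU[OF pa] UX by auto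
  have "continuous_map (top_of_set {a..b}) X (act \<gamma> \<circ> (s \<circ> p))"
  proof (intro continuous_map_compose)
    show "continuous_map (top_of_set {a..b}) (subtopology (orbit_space \<Gamma> X act) ?V) p"
      using p pU by (auto simp: continuous_map_in_subtopology)
    show "continuous_map (subtopology (orbit_space \<Gamma> X act) ?V) X s"
      using cs continuous_map_in_subtopology by blast
  qed (rule continuous_map_act[OF \<gamma>(1)])
  moreover have "orbit \<Gamma> act ((act \<gamma> \<circ> (s \<circ> p)) t) = p t" if "t \<in> {a..b}" for t
  proof -
    have "p t \<in> ?V"
      using pU that by blast
    then show ?thesis
      using sU[of "p t"] os[of "p t"] UX orbit_act \<gamma>(1) by auto
  qed
  ultimately show "\<exists>f. continuous_map (top_of_set {a..b}) X f \<and> f a = z \<and> (\<forall>t\<in>{a..b}. orbit \<Gamma> act (f t) = p t)"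
    using \<gamma>(2) by (intro exI[of _ "act \<gamma> \<circ> (s \<circ> p)"]) auto
qed

text \<open>Evenly covered neighbourhoods give lifts over short intervals around each time, and
  lifts concatenate; the bisection principle \<open>Bolzano\<close> then yields one over the whole
  unit interval.\<close>

lemma path_lifting:
  assumes p: "pathin (orbit_space \<Gamma> X act) p"
  obtains f where "pathin X f" "\<And>t. t \<in> {0..1} \<Longrightarrow> orbit \<Gamma> act (f t) = p t"
proof -
  have cp: "continuous_map (top_of_set {0..1}) (orbit_space \<Gamma> X act) p"
    using p by (simp add: pathin_def)
  \<comment> \<open>The short intervals around a time that \<open>Bolzano\<close> asks for may leave
    the unit interval, where nothing is known about \<open>p\<close>; hence the guard.\<close>
  define P where "P a b \<longleftrightarrow> (0 \<le> a \<and> b \<le> 1 \<longrightarrow> lifts_on p a b)" for a b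
  have "P 0 1"
  proof (rule Bolzano)
    show "P a c" if "P a b" "P b c" "a \<le> b" "b \<le> c" for a b c
      using that lifts_on_trans unfolding P_def by (meson order_trans)
  next
    fix t :: real assume t: "0 \<le> t" "t \<le> 1"
    then have "p t \<in> topspace (orbit_space \<Gamma> X act)"
      using continuous_map_image_subset_topspace[OF cp] by auto
    then obtain x where x: "x \<in> topspace X" "p t = orbit \<Gamma> act x"
      by auto
    then obtain U where U: "openin X U" "x \<in> U"
      and disj: "\<And>\<gamma>. \<gamma> \<in> carrier \<Gamma> \<Longrightarrow> \<gamma> \<noteq> \<one>\<^bsub>\<Gamma>\<^esub> \<Longrightarrow> act \<gamma> ` U \<inter> U = {}"
      using prop_disc unfolding properly_discontinuous_def by meson
    have "openin (orbit_space \<Gamma> X act) (orbit \<Gamma> act ` U)"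
      using U open_map_orbit unfolding open_map_def by blast
    then have "openin (top_of_set {0..1}) {s \<in> {0..1}. p s \<in> orbit \<Gamma> act ` U}"
      using openin_continuous_map_preimage[OF cp] by simp
    moreover have "t \<in> {s \<in> {0..1}. p s \<in> orbit \<Gamma> act ` U}"
      using t x U by auto
    ultimately obtain d where d: "d > 0"
      "\<And>s. s \<in> {0..1} \<Longrightarrow> dist s t < d \<Longrightarrow> p s \<in> orbit \<Gamma> act ` U"
      unfolding openin_euclidean_subtopology_iff by blast
    have "P a b" if ab: "a \<le> t" "t \<le> b" "b - a < d" for a b
      unfolding P_def
    proof (intro impI, elim conjE)
      assume ab': "0 \<le> a" "b \<le> 1"
      show "lifts_on p a b"
      proof (rule lifts_on_local[OF _ U(1) disj])
        show "continuous_map (top_of_set {a..b}) (orbit_space \<Gamma> X act) p"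
          using continuous_map_from_subtopology_mono[OF cp] ab' by auto
        show "p ` {a..b} \<subseteq> orbit \<Gamma> act ` U"
          using d(2) ab ab' by (auto simp: dist_real_def)
      qed (use ab in auto)
    qed
    then show "\<exists>d>0. \<forall>a b. a \<le> t \<and> t \<le> b \<and> b - a < d \<longrightarrow> P a b"
      using d(1) by blast
  qed simp
  \<comment> \<open>A representative of the orbit \<open>p 0\<close> serves as start point of the
    lift.\<close>
  moreover have "p 0 \<in> topspace (orbit_space \<Gamma> X act)"
    using p by (rule path_start_in_topspace)
  ultimately show thesis
    using that unfolding P_def lifts_on_def pathin_def by auto
qed

end

section \<open>The circle as a quotient of the unit interval\<close>

text \<open>A continuous map from the compact interval to the Hausdorff circle is closed, and a
  closed continuous surjection is a quotient map.\<close>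

lemma quotient_map_circle: "quotient_map (top_of_set {0..1}) circle (\<lambda>t. cis (2 * pi * t))"
proof (rule continuous_closed_imp_quotient_map)
  show c: "continuous_map (top_of_set {0..1}) circle (\<lambda>t. cis (2 * pi * t))"
    unfolding circle_def by (auto intro!: continuous_intros)
  show "closed_map (top_of_set {0..1}) circle (\<lambda>t. cis (2 * pi * t))"
  proof (rule continuous_imp_closed_map_gen[OF _ _ c])
    show "kc_space circle"
      by (simp add: circle_def Hausdorff_imp_kc_space Hausdorff_space_subtopology)
  qed (simp add: compact_space_subtopology)
  have "z \<in> (\<lambda>t. cis (2 * pi * t)) ` {0..1}" if "cmod z = 1" for z
  proof
    show "z = cis (2 * pi * (Arg2pi z / (2 * pi)))"
      using that complex_norm_eq_1_exp by (simp add: cis_conv_exp)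
    show "Arg2pi z / (2 * pi) \<in> {0..1}"
      using Arg2pi[of z] by simp
  qed
  then show "(\<lambda>t. cis (2 * pi * t)) ` topspace (top_of_set {0..1}) = topspace circle"
    by (auto simp: circle_def)
qed

text \<open>\<open>Arg2pi\<close> takes values in the half-open range from 0 to 2 pi, so the end
  point \<open>t = 1\<close> wraps around to angle 0.\<close>

lemma Arg2pi_cis_2pi: "t \<in> {0..1} \<Longrightarrow> Arg2pi (cis (2 * pi * t)) = (if t = 1 then 0 else 2 * pi * t)"
  by (rule Arg2pi_unique[of 1]) (auto simp: cis_conv_exp[symmetric])

lemma loop_factors_through_circle:
  assumes f: "pathin X f" and loop: "f 0 = f 1"
  obtains l where "continuous_map circle X l" "\<And>t. t \<in> {0..1} \<Longrightarrow> l (cis (2 * pi * t)) = f t"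
proof -
  \<comment> \<open>The right-hand side depends on \<open>t\<close> only through its point on the
    circle, so \<open>f\<close> is constant on the fibres of the parametrization; at
    \<open>t = 1\<close> this is the hypothesis \<open>loop\<close>.\<close>
  have eq: "f t = f (Arg2pi (cis (2 * pi * t)) / (2 * pi))" if "t \<in> {0..1}" for t
    using that loop by (simp add: Arg2pi_cis_2pi)
  show thesis
  proof (rule quotient_map_lift_exists[OF quotient_map_circle])
    show "continuous_map (top_of_set {0..1}) X f"
      using f by (simp add: pathin_def)
    show "f s = f t" if "s \<in> topspace (top_of_set {0..1})" "t \<in> topspace (top_of_set {0..1})"
      "cis (2 * pi * s) = cis (2 * pi * t)" for s t
      using that eq[of s] eq[of t] by simp
  qed (use that in auto)
qed

section \<open>Path components in topological groups\<close>

lemma topological_groupD: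
  assumes "topological_group G T"
  shows "group G" "topspace T = carrier G"
    "continuous_map (prod_topology T T) T (\<lambda>(g, h). g \<otimes>\<^bsub>G\<^esub> h)"
  using assms by (auto simp: topological_group_def)

lemma continuous_map_group_mult:
  assumes "topological_group G T" "continuous_map Z T f" "continuous_map Z T g"
  shows "continuous_map Z T (\<lambda>z. f z \<otimes>\<^bsub>G\<^esub> g z)"
  using continuous_map_compose[OF continuous_map_pairedI[OF assms(2,3)] topological_groupD(3)[OF assms(1)]]
  by (simp add: o_def)

lemma path_component_of_mult_right:
  assumes G: "topological_group G T" and ab: "path_component_of T a b" and c: "c \<in> carrier G"
  shows "path_component_of T (a \<otimes>\<^bsub>G\<^esub> c) (b \<otimes>\<^bsub>G\<^esub> c)"
proof -
  obtain p where p: "pathin T p" "p 0 = a" "p 1 = b"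
    using ab by (auto simp: path_component_of_def)
  have "pathin T (\<lambda>t. p t \<otimes>\<^bsub>G\<^esub> c)"
    using p(1) c topological_groupD(2)[OF G] by (auto simp: pathin_def intro!: continuous_map_group_mult[OF G])
  then show ?thesis
    unfolding path_component_of_def using p by (intro exI[of _ "\<lambda>t. p t \<otimes>\<^bsub>G\<^esub> c"]) auto
qed

text \<open>This converts membership in the identity component into equality of cosets, the form in
  which injectivity on the group of components is stated. Right translation of paths by
  \<open>h\<close> and by its inverse maps the component into itself.\<close>

lemma identity_path_component_coset:
  assumes G: "topological_group G T" and h: "h \<in> identity_path_component G T"
  shows "identity_path_component G T #>\<^bsub>G\<^esub> h = identity_path_component G T"
proof -
  interpret group G
    using G by (rule topological_groupD)
  have hG: "h \<in> carrier G" and h1: "path_component_of T \<one>\<^bsub>G\<^esub> h"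
    using h by (auto simp: identity_path_component_def)
  have 1: "a \<otimes>\<^bsub>G\<^esub> h \<in> identity_path_component G T" if "a \<in> identity_path_component G T" for a
  proof -
    have a: "a \<in> carrier G" "path_component_of T \<one>\<^bsub>G\<^esub> a"
      using that by (auto simp: identity_path_component_def)
    then have "path_component_of T h (a \<otimes>\<^bsub>G\<^esub> h)"
      using path_component_of_mult_right[OF G a(2) hG] hG by simp
    then show ?thesis
      using a hG path_component_of_trans[OF h1] by (simp add: identity_path_component_def)
  qed
  \<comment> \<open>A path from \<open>h\<close> to \<open>a\<close>, found by way of the identity,
    becomes after right translation by the inverse of \<open>h\<close> a path that starts at the
    identity.\<close>
  have 2: "a \<otimes>\<^bsub>G\<^esub> inv\<^bsub>G\<^esub> h \<in> identity_path_component G T" if "a \<in> identity_path_component G T" for a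
  proof -
    have a: "a \<in> carrier G" "path_component_of T h a"
      using that path_component_of_trans[OF path_component_of_sym[OF h1]]
      by (auto simp: identity_path_component_def)
    then show ?thesis
      using path_component_of_mult_right[OF G a(2), of "inv\<^bsub>G\<^esub> h"] hG
      by (simp add: identity_path_component_def)
  qed
  have 3: "a = (a \<otimes>\<^bsub>G\<^esub> inv\<^bsub>G\<^esub> h) \<otimes>\<^bsub>G\<^esub> h" if "a \<in> identity_path_component G T" for a
    using that hG by (simp add: identity_path_component_def m_assoc)
  show ?thesis
    unfolding r_coset_def using 1 2 3 by blast
qed

section \<open>The diagonal action on the product of X and G\<close>

text \<open>The name reflects that the associated bundle has locally constant transition functions,
  given by values of \<phi>.\<close>

locale flat_bundle = base: properly_discontinuous_action \<Gamma> X act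
  for \<Gamma> :: "'c monoid" and X :: "'a topology" and act :: "'c \<Rightarrow> 'a \<Rightarrow> 'a" +
  fixes G :: "'g monoid" and T :: "'g topology" and \<phi> :: "'c \<Rightarrow> 'g"
  assumes G: "topological_group G T"
    and compact: "compact_space T" and Hausdorff: "Hausdorff_space T"
    and \<phi>: "\<phi> \<in> hom \<Gamma> G"
begin

sublocale G: group G
  using G by (rule topological_groupD)

sublocale hom: group_hom \<Gamma> G \<phi>
  by unfold_locales (rule \<phi>)

lemma topspace_T [simp]: "topspace T = carrier G"
  using G by (rule topological_groupD)

abbreviation diag where "diag \<equiv> diagonal_action X G act \<phi>"

lemma diag_apply [simp]:
  "x \<in> topspace X \<Longrightarrow> g \<in> carrier G \<Longrightarrow> diag \<gamma> (x, g) = (act \<gamma> x, \<phi> \<gamma> \<otimes>\<^bsub>G\<^esub> g)"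
  by (simp add: diagonal_action_def)

lemma diag_mult:
  assumes "\<gamma> \<in> carrier \<Gamma>" "\<delta> \<in> carrier \<Gamma>" "x \<in> topspace X" "g \<in> carrier G"
  shows "diag (\<gamma> \<otimes>\<^bsub>\<Gamma>\<^esub> \<delta>) (x, g) = diag \<gamma> (diag \<delta> (x, g))"
  using assms by (simp add: base.act_closed base.composition_rule G.m_assoc)

lemma diag_closed:
  "\<gamma> \<in> carrier \<Gamma> \<Longrightarrow> x \<in> topspace X \<Longrightarrow> g \<in> carrier G \<Longrightarrow> diag \<gamma> (x, g) \<in> topspace X \<times> carrier G"
  by (simp add: base.act_closed)

lemma diag_Bij:
  assumes \<gamma>: "\<gamma> \<in> carrier \<Gamma>"
  shows "diag \<gamma> \<in> Bij (topspace X \<times> carrier G)"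
proof -
  have inv: "diag (inv\<^bsub>\<Gamma>\<^esub> \<delta>) (diag \<delta> (x, g)) = (x, g)"
    if "\<delta> \<in> carrier \<Gamma>" "x \<in> topspace X" "g \<in> carrier G" for \<delta> x g
  proof -
    have "diag (inv\<^bsub>\<Gamma>\<^esub> \<delta> \<otimes>\<^bsub>\<Gamma>\<^esub> \<delta>) (x, g) = (x, g)"
      using that by (simp add: base.act_one)
    then show ?thesis
      using that diag_mult by (metis base.inv_closed)
  qed
  have "bij_betw (diag \<gamma>) (topspace X \<times> carrier G) (topspace X \<times> carrier G)"
  proof (rule bij_betw_byWitness[where f' = "diag (inv\<^bsub>\<Gamma>\<^esub> \<gamma>)"])
    show "\<forall>z\<in>topspace X \<times> carrier G. diag (inv\<^bsub>\<Gamma>\<^esub> \<gamma>) (diag \<gamma> z) = z"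
      using inv \<gamma> by auto
    show "\<forall>z\<in>topspace X \<times> carrier G. diag \<gamma> (diag (inv\<^bsub>\<Gamma>\<^esub> \<gamma>) z) = z"
      using inv[of "inv\<^bsub>\<Gamma>\<^esub> \<gamma>"] \<gamma> by auto
    show "diag \<gamma> ` (topspace X \<times> carrier G) \<subseteq> topspace X \<times> carrier G"
      "diag (inv\<^bsub>\<Gamma>\<^esub> \<gamma>) ` (topspace X \<times> carrier G) \<subseteq> topspace X \<times> carrier G"
      using diag_closed[OF \<gamma>] diag_closed[OF base.inv_closed[OF \<gamma>]] by auto
  qed
  then show ?thesis
    by (simp add: Bij_def diagonal_action_def)
qed

lemma diag_group_action: "group_action \<Gamma> (topspace X \<times> carrier G) diag"
proof -
  have "diag (\<gamma> \<otimes>\<^bsub>\<Gamma>\<^esub> \<delta>) = compose (topspace X \<times> carrier G) (diag \<gamma>) (diag \<delta>)"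
    if "\<gamma> \<in> carrier \<Gamma>" "\<delta> \<in> carrier \<Gamma>" for \<gamma> \<delta>
  proof
    fix z
    show "diag (\<gamma> \<otimes>\<^bsub>\<Gamma>\<^esub> \<delta>) z = compose (topspace X \<times> carrier G) (diag \<gamma>) (diag \<delta>) z"
    proof (cases "z \<in> topspace X \<times> carrier G")
      case True
      then show ?thesis
        using diag_mult that by (auto simp: compose_def)
    next
      case False
      \<comment> \<open>Equality of functions is required at every \<open>z\<close>; outside the
        product both sides are restricted functions with value \<open>undefined\<close>.\<close>
      then show ?thesis
        unfolding diagonal_action_def by (simp only: compose_def restrict_apply if_False)
    qed
  qed
  then have "diag \<in> hom \<Gamma> (BijGroup (topspace X \<times> carrier G))"
    by (auto simp: hom_def BijGroup_def diag_Bij)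
  then show ?thesis
    by (simp add: group_action_def group_hom_def group_hom_axioms_def group_BijGroup base.is_group)
qed

text \<open>The first coordinate alone separates the translates, whatever \<phi> does on the
  fibre.\<close>

lemma diag_translates_disjoint:
  assumes U: "U \<subseteq> topspace X" and "act \<gamma> ` U \<inter> U = {}"
  shows "diag \<gamma> ` (U \<times> carrier G) \<inter> (U \<times> carrier G) = {}"
  using assms by (auto simp: subset_iff disjoint_iff)

text \<open>With this instance the results on orbit maps, path lifting in particular, apply to the
  projection from the product to the total space of the bundle.\<close>

sublocale prod: properly_discontinuous_action \<Gamma> "prod_topology X T" diag
proof
  have "continuous_map (prod_topology X T) (prod_topology X T) (diag \<gamma>)" if "\<gamma> \<in> carrier \<Gamma>" for \<gamma>
  proof (rule continuous_map_eq)
    have "continuous_map (prod_topology X T) X (\<lambda>z. act \<gamma> (fst z))"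
      using continuous_map_compose[OF continuous_map_fst base.continuous_map_act[OF that]]
      by (simp add: o_def)
    moreover have "continuous_map (prod_topology X T) T (\<lambda>z. \<phi> \<gamma> \<otimes>\<^bsub>G\<^esub> snd z)"
      using that by (intro continuous_map_group_mult[OF G] continuous_map_snd) simp
    ultimately show "continuous_map (prod_topology X T) (prod_topology X T)
            (\<lambda>z. (act \<gamma> (fst z), \<phi> \<gamma> \<otimes>\<^bsub>G\<^esub> snd z))"
      by (rule continuous_map_pairedI)
  qed auto
  then show "continuous_action \<Gamma> (prod_topology X T) diag"
    using diag_group_action by (simp add: continuous_action_def)
  show "properly_discontinuous \<Gamma> (prod_topology X T) diag"
    unfolding properly_discontinuous_def
  proof
    fix z assume "z \<in> topspace (prod_topology X T)"
    then obtain x g where z: "z = (x, g)" "x \<in> topspace X" "g \<in> carrier G"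
      by auto
    then obtain U where U: "openin X U" "x \<in> U"
      "\<And>\<gamma>. \<gamma> \<in> carrier \<Gamma> \<Longrightarrow> \<gamma> \<noteq> \<one>\<^bsub>\<Gamma>\<^esub> \<Longrightarrow> act \<gamma> ` U \<inter> U = {}"
      using base.prop_disc unfolding properly_discontinuous_def by meson
    have "openin (prod_topology X T) (U \<times> carrier G)"
      using U(1) by (metis openin_prod_Times_iff openin_topspace topspace_T)
    then show "\<exists>U. openin (prod_topology X T) U \<and> z \<in> U \<and>
        (\<forall>\<gamma>\<in>carrier \<Gamma>. \<gamma> \<noteq> \<one>\<^bsub>\<Gamma>\<^esub> \<longrightarrow> diag \<gamma> ` U \<inter> U = {})"
      using U z diag_translates_disjoint[OF openin_subset[OF U(1)]] by (intro exI[of _ "U \<times> carrier G"]) auto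
  qed
qed

section \<open>The associated bundle as a principal bundle\<close>

abbreviation E where "E \<equiv> orbit_space \<Gamma> (prod_topology X T) diag"
abbreviation Y where "Y \<equiv> orbit_space \<Gamma> X act"
abbreviation rtrans :: "('a \<times> 'g) set \<Rightarrow> 'g \<Rightarrow> ('a \<times> 'g) set"
  where "rtrans e h \<equiv> (\<lambda>(x, g). (x, g \<otimes>\<^bsub>G\<^esub> h)) ` e"

lemma orbit_diag:
  assumes "x \<in> topspace X" "g \<in> carrier G"
  shows "orbit \<Gamma> diag (x, g) = (\<lambda>\<gamma>. (act \<gamma> x, \<phi> \<gamma> \<otimes>\<^bsub>G\<^esub> g)) ` carrier \<Gamma>"
  using assms by (auto simp: orbit_def)

lemma proj_orbit:
  assumes "x \<in> topspace X" "g \<in> carrier G"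
  shows "fst ` orbit \<Gamma> diag (x, g) = orbit \<Gamma> act x"
  unfolding orbit_diag[OF assms] by (auto simp: orbit_def image_iff)

text \<open>By associativity, left multiplication by \<open>\<phi> \<gamma>\<close> commutes with
  right multiplication by \<open>h\<close>, so right translation takes orbits to orbits.\<close>

lemma rtrans_orbit:
  assumes "x \<in> topspace X" "g \<in> carrier G" "h \<in> carrier G"
  shows "rtrans (orbit \<Gamma> diag (x, g)) h = orbit \<Gamma> diag (x, g \<otimes>\<^bsub>G\<^esub> h)"
  using assms by (simp add: orbit_diag image_image G.m_assoc cong: image_cong)

lemma continuous_map_proj: "continuous_map E Y ((`) fst)"
proof (rule continuous_compose_quotient_map[OF prod.quotient_map_orbit])
  show "continuous_map (prod_topology X T) Y ((`) fst \<circ> orbit \<Gamma> diag)"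
  proof (rule continuous_map_eq)
    show "continuous_map (prod_topology X T) Y (orbit \<Gamma> act \<circ> fst)"
      by (rule continuous_map_compose[OF continuous_map_fst base.continuous_map_orbit])
  qed (clarsimp simp: proj_orbit)
qed

text \<open>Continuity can be tested on representatives because the orbit map times the identity of
  \<open>T\<close> is again a quotient map, \<open>T\<close> being compact Hausdorff and thus
  locally compact.\<close>

lemma continuous_map_rtrans: "continuous_map (prod_topology E T) E (\<lambda>(e, h). rtrans e h)"
proof (rule continuous_compose_quotient_map)
  show "quotient_map (prod_topology (prod_topology X T) T) (prod_topology E T)
          (\<lambda>(z, h). (orbit \<Gamma> diag z, h))"
    using compact Hausdorff prod.quotient_map_orbit
    by (intro quotient_map_prod_left) (auto simp: compact_imp_locally_compact_space)
  show "continuous_map (prod_topology (prod_topology X T) T) E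
          ((\<lambda>(e, h). rtrans e h) \<circ> (\<lambda>(z, h). (orbit \<Gamma> diag z, h)))"
  proof (rule continuous_map_eq)
    let ?Z = "prod_topology (prod_topology X T) T"
    have "continuous_map ?Z X (fst \<circ> fst)" "continuous_map ?Z T (snd \<circ> fst)"
      by (rule continuous_map_compose[OF continuous_map_fst continuous_map_fst],
          rule continuous_map_compose[OF continuous_map_fst continuous_map_snd])
    then have "continuous_map ?Z (prod_topology X T)
        (\<lambda>w. ((fst \<circ> fst) w, (snd \<circ> fst) w \<otimes>\<^bsub>G\<^esub> snd w))"
      by (intro continuous_map_pairedI continuous_map_group_mult[OF G] continuous_map_snd)
    then show "continuous_map ?Z E
        (orbit \<Gamma> diag \<circ> (\<lambda>w. ((fst \<circ> fst) w, (snd \<circ> fst) w \<otimes>\<^bsub>G\<^esub> snd w)))"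
      by (rule continuous_map_compose[OF _ prod.continuous_map_orbit])
  qed (clarsimp simp: rtrans_orbit)
qed

text \<open>The orbit maps on \<open>U\<close> and on \<open>U \<times> carrier G\<close> are both
  homeomorphisms onto their images. Going up along the inverse of the second and down along the
  first times the identity gives the trivialization.\<close>

lemma restricted_bundle_trivial:
  assumes U: "openin X U"
    and disj: "\<And>\<gamma>. \<gamma> \<in> carrier \<Gamma> \<Longrightarrow> \<gamma> \<noteq> \<one>\<^bsub>\<Gamma>\<^esub> \<Longrightarrow> act \<gamma> ` U \<inter> U = {}"
  shows "trivial_bundle G T (restrict_bundle (associated_bundle \<Gamma> X act G T \<phi>) (orbit \<Gamma> act ` U))"
proof -
  let ?V = "orbit \<Gamma> act ` U"
  let ?E = "subtopology E {e. fst ` e \<in> ?V}" and ?B = "prod_topology (subtopology Y ?V) T"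
  let ?UG = "prod_topology (subtopology X U) T"
  have UX: "U \<subseteq> topspace X"
    using U by (rule openin_subset)
  have UG: "?UG = subtopology (prod_topology X T) (U \<times> carrier G)"
    by (simp add: prod_topology_subtopology)
  \<comment> \<open>Every orbit lying over the image of \<open>U\<close> has a representative with
    first coordinate in \<open>U\<close>, found by applying the \<gamma> that moves \<open>x\<close>
    into \<open>U\<close>.\<close>
  have topE: "topspace ?E = orbit \<Gamma> diag ` (U \<times> carrier G)"
  proof
    show "topspace ?E \<subseteq> orbit \<Gamma> diag ` (U \<times> carrier G)"
    proof
      fix e assume "e \<in> topspace ?E"
      then obtain x g u where e: "e = orbit \<Gamma> diag (x, g)" "x \<in> topspace X" "g \<in> carrier G"
        and u: "u \<in> U" "orbit \<Gamma> act x = orbit \<Gamma> act u"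
        by (auto simp: proj_orbit)
      then obtain \<gamma> where \<gamma>: "\<gamma> \<in> carrier \<Gamma>" "u = act \<gamma> x"
        using base.orbit_eq_iff UX by blast
      then have "e = orbit \<Gamma> diag (u, \<phi> \<gamma> \<otimes>\<^bsub>G\<^esub> g)"
        using e prod.orbit_act[of \<gamma> "(x, g)"] by simp
      moreover have "(u, \<phi> \<gamma> \<otimes>\<^bsub>G\<^esub> g) \<in> U \<times> carrier G"
        using u \<gamma> e by simp
      ultimately show "e \<in> orbit \<Gamma> diag ` (U \<times> carrier G)"
        by (rule image_eqI)
    qed
    show "orbit \<Gamma> diag ` (U \<times> carrier G) \<subseteq> topspace ?E"
      using UX by (auto simp: proj_orbit subset_iff)
  qed
  have "homeomorphic_map ?UG (subtopology E (orbit \<Gamma> diag ` (U \<times> carrier G))) (orbit \<Gamma> diag)"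
    unfolding UG
    by (intro prod.homeomorphic_map_orbit diag_translates_disjoint disj UX)
      (use U in \<open>auto simp: openin_prod_Times_iff simp flip: topspace_T\<close>)
  \<comment> \<open>A subspace depends only on the part of the set inside the space, and
    \<open>topE\<close> identifies that part.\<close>
  moreover have "subtopology E (orbit \<Gamma> diag ` (U \<times> carrier G)) = ?E"
    using subtopology_restrict[of E "{e. fst ` e \<in> ?V}"] unfolding topE[symmetric]
    by (simp only: topspace_subtopology)
  ultimately obtain s where s: "homeomorphic_maps ?UG ?E (orbit \<Gamma> diag) s"
    by (metis homeomorphic_map_maps)
  have r: "homeomorphic_map ?UG ?B (\<lambda>(u, g). (orbit \<Gamma> act u, g))"
  proof -
    obtain s' where "homeomorphic_maps (subtopology X U) (subtopology Y ?V) (orbit \<Gamma> act) s'"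
      using base.homeomorphic_map_orbit[OF U disj] homeomorphic_map_maps by blast
    then have "homeomorphic_maps ?UG ?B (\<lambda>(u, g). (orbit \<Gamma> act u, g)) (\<lambda>(u, g). (s' u, g))"
      using homeomorphic_maps_prod[of "subtopology X U" T "subtopology Y ?V" T
          "orbit \<Gamma> act" "\<lambda>x. x" s' "\<lambda>x. x"] homeomorphic_maps_id[of T T]
      by (simp add: id_def)
    then show ?thesis
      using homeomorphic_map_maps by blast
  qed
  let ?h = "(\<lambda>(u, g). (orbit \<Gamma> act u, g)) \<circ> s"
  have h: "homeomorphic_map ?E ?B ?h"
    using s r by (meson homeomorphic_map_compose homeomorphic_maps_map)
  \<comment> \<open>Evaluation on representatives over \<open>U\<close> reduces compatibility with
    the projection and with the group action to a computation.\<close>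
  have h_orbit: "?h (orbit \<Gamma> diag (u, g)) = (orbit \<Gamma> act u, g)" if "u \<in> U" "g \<in> carrier G" for u g
    using s that UX by (auto simp: homeomorphic_maps_def)
  show ?thesis
    unfolding trivial_bundle_def restrict_bundle_def associated_bundle_def gbundle.simps
  proof (intro exI conjI)
    show "homeomorphic_map ?E ?B ?h"
      by (rule h)
    show "\<forall>e\<in>topspace ?E. fst (?h e) = fst ` e"
      unfolding topE
    proof
      fix e assume "e \<in> orbit \<Gamma> diag ` (U \<times> carrier G)"
      then obtain u g where e: "e = orbit \<Gamma> diag (u, g)" "u \<in> U" "g \<in> carrier G"
        by auto
      show "fst (?h e) = fst ` e"
        unfolding e(1) h_orbit[OF e(2,3)] using e UX by (simp add: proj_orbit subset_iff)
    qed
    show "\<forall>e\<in>topspace ?E. \<forall>k\<in>carrier G. ?h (rtrans e k) = (fst (?h e), snd (?h e) \<otimes>\<^bsub>G\<^esub> k)"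
      unfolding topE
    proof (intro ballI)
      fix e k assume "e \<in> orbit \<Gamma> diag ` (U \<times> carrier G)" and k: "k \<in> carrier G"
      then obtain u g where e: "e = orbit \<Gamma> diag (u, g)" "u \<in> U" "g \<in> carrier G"
        by auto
      then have "rtrans e k = orbit \<Gamma> diag (u, g \<otimes>\<^bsub>G\<^esub> k)"
        using rtrans_orbit UX k by blast
      then show "?h (rtrans e k) = (fst (?h e), snd (?h e) \<otimes>\<^bsub>G\<^esub> k)"
        using e k h_orbit by (metis G.m_closed fst_conv snd_conv)
    qed
  qed
qed

lemma principal_bundle: "principal_bundle G T (associated_bundle \<Gamma> X act G T \<phi>)"
  unfolding principal_bundle_def
proof (intro conjI ballI)
  show "topological_group G T"
    by (rule G)
  show "continuous_map (total_space (associated_bundle \<Gamma> X act G T \<phi>))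
     (base_space (associated_bundle \<Gamma> X act G T \<phi>)) (proj (associated_bundle \<Gamma> X act G T \<phi>))"
    by (simp add: associated_bundle_def continuous_map_proj)
  show "continuous_map (prod_topology (total_space (associated_bundle \<Gamma> X act G T \<phi>)) T)
     (total_space (associated_bundle \<Gamma> X act G T \<phi>))
     (\<lambda>(e, g). ract (associated_bundle \<Gamma> X act G T \<phi>) e g)"
    using continuous_map_rtrans by (simp add: associated_bundle_def)
next
  fix b assume "b \<in> topspace (base_space (associated_bundle \<Gamma> X act G T \<phi>))"
  then obtain x where x: "x \<in> topspace X" "b = orbit \<Gamma> act x"
    by (auto simp: associated_bundle_def)
  then obtain U where U: "openin X U" "x \<in> U"
      "\<And>\<gamma>. \<gamma> \<in> carrier \<Gamma> \<Longrightarrow> \<gamma> \<noteq> \<one>\<^bsub>\<Gamma>\<^esub> \<Longrightarrow> act \<gamma> ` U \<inter> U = {}"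
    using base.prop_disc unfolding properly_discontinuous_def by meson
  have "openin Y (orbit \<Gamma> act ` U)"
    using U base.open_map_orbit unfolding open_map_def by blast
  then show "\<exists>V. openin (base_space (associated_bundle \<Gamma> X act G T \<phi>)) V \<and> b \<in> V \<and>
      trivial_bundle G T (restrict_bundle (associated_bundle \<Gamma> X act G T \<phi>) V)"
    using restricted_bundle_trivial[OF U(1,3)] U(2) x
    by (intro exI[of _ "orbit \<Gamma> act ` U"]) (auto simp: associated_bundle_def)
\<comment> \<open>What remains are the algebraic laws of the right action and its compatibility with
  the projection, checked on representatives of orbits.\<close>
qed (clarsimp simp: associated_bundle_def rtrans_orbit proj_orbit G.m_assoc)+

section \<open>Incompressibility\<close>

text \<open>The aim is a closed lift to \<open>X\<close>: a lift as a path always exists, and the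
  section \<open>s\<close> over the loop is what forces its end points to coincide.\<close>

lemma section_over_loop_lifts:
  assumes inj: "inj_on (\<lambda>\<gamma>. identity_path_component G T #>\<^bsub>G\<^esub> \<phi> \<gamma>) (carrier \<Gamma>)"
    and s: "continuous_map circle E s" and l: "\<And>z. z \<in> topspace circle \<Longrightarrow> fst ` s z = l z"
  obtains k where "continuous_map circle X k" "\<And>z. z \<in> topspace circle \<Longrightarrow> orbit \<Gamma> act (k z) = l z"
proof -
  let ?c = "\<lambda>t. cis (2 * pi * t)"
  have c: "quotient_map (top_of_set {0..1}) circle ?c"
    by (rule quotient_map_circle)
  have "pathin E (s \<circ> ?c)"
    unfolding pathin_def by (intro continuous_map_compose[OF _ s] quotient_imp_continuous_map c)
  then obtain f where f: "pathin (prod_topology X T) f"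
    and fs: "\<And>t. t \<in> {0..1} \<Longrightarrow> orbit \<Gamma> diag (f t) = s (?c t)"
    using prod.path_lifting by (metis o_apply)
  have f_in: "fst (f t) \<in> topspace X" "snd (f t) \<in> carrier G" if "t \<in> {0..1}" for t
    using path_image_subset_topspace[OF f] that by (auto simp: Pi_iff mem_Times_iff)
  have x: "pathin X (fst \<circ> f)" and g: "pathin T (snd \<circ> f)"
    using pathin_compose[OF f] continuous_map_fst continuous_map_snd by blast+
  \<comment> \<open>The parametrization has the same value at 0 and 1, so both end points of the
    lift represent one point of \<open>E\<close>.\<close>
  have "orbit \<Gamma> diag (f 0) = orbit \<Gamma> diag (f 1)"
    using fs[of 0] fs[of 1] by simp
  then obtain \<gamma> where \<gamma>: "\<gamma> \<in> carrier \<Gamma>" and "f 1 = diag \<gamma> (f 0)"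
    using prod.orbit_eq_iff path_start_in_topspace[OF f] path_finish_in_topspace[OF f] by blast
  then have f1: "fst (f 1) = act \<gamma> (fst (f 0))" "snd (f 1) = \<phi> \<gamma> \<otimes>\<^bsub>G\<^esub> snd (f 0)"
    using f_in[of 0] by (metis atLeastAtMost_iff diag_apply fst_conv snd_conv order_refl prod.collapse zero_le_one)+
  have "path_component_of T (snd (f 0)) (snd (f 1))"
    using g unfolding path_component_of_def by (intro exI[of _ "snd \<circ> f"]) auto
  \<comment> \<open>Right translation by the inverse of \<open>snd (f 0)\<close> moves the start of
    the fibre path to the identity and its end to \<open>\<phi> \<gamma>\<close>.\<close>
  from path_component_of_mult_right[OF G this, of "inv\<^bsub>G\<^esub> (snd (f 0))"]
  have "path_component_of T \<one>\<^bsub>G\<^esub> (\<phi> \<gamma>)"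
    using f1 f_in[of 0] \<gamma> by (simp add: G.m_assoc)
  then have "\<phi> \<gamma> \<in> identity_path_component G T"
    using \<gamma> by (simp add: identity_path_component_def)
  \<comment> \<open>The identity of \<Gamma> yields the same coset as \<gamma>, so injectivity
    compares the two.\<close>
  moreover have "\<phi> \<one>\<^bsub>\<Gamma>\<^esub> \<in> identity_path_component G T"
    by (simp add: identity_path_component_def path_component_of_refl)
  ultimately have "\<gamma> = \<one>\<^bsub>\<Gamma>\<^esub>"
    using inj_onD[OF inj _ \<gamma> base.one_closed] identity_path_component_coset[OF G] by metis
  then have "fst (f 1) = fst (f 0)"
    using f1 f_in[of 0] by (simp add: base.act_one)
  then obtain k where k: "continuous_map circle X k" "\<And>t. t \<in> {0..1} \<Longrightarrow> k (?c t) = fst (f t)"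
    using loop_factors_through_circle[OF x] by (metis o_apply)
  have "orbit \<Gamma> act (k z) = l z" if z: "z \<in> topspace circle" for z
  proof -
    have "z \<in> ?c ` {0..1}"
      using z quotient_imp_surjective_map[OF c] by simp
    then obtain t where t: "t \<in> {0..1}" "z = ?c t"
      by blast
    then show ?thesis
      using k(2) fs[OF t(1)] f_in[OF t(1)] l[OF z] proj_orbit by (metis prod.collapse)
  qed
  with k(1) that show thesis
    by blast
qed

lemma incompressible:
  assumes sc: "simply_connected_space X"
    and inj: "inj_on (\<lambda>\<gamma>. identity_path_component G T #>\<^bsub>G\<^esub> \<phi> \<gamma>) (carrier \<Gamma>)"
  shows "incompressible G T (associated_bundle \<Gamma> X act G T \<phi>)"
  unfolding incompressible_def
proof (intro conjI allI impI notI principal_bundle, elim conjE)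
  fix l
  assume "\<not> nullhomotopic_loop (base_space (associated_bundle \<Gamma> X act G T \<phi>)) l"
  then have nl: "\<not> nullhomotopic_loop Y l"
    by (simp add: associated_bundle_def)
  let ?P = "subtopology (prod_topology circle E) {(z, e). l z = fst ` e}"
  assume "trivial_bundle G T (pullback_bundle circle l (associated_bundle \<Gamma> X act G T \<phi>))"
  then obtain h where h: "homeomorphic_map ?P (prod_topology circle T) h"
    and h_fst: "\<And>e. e \<in> topspace ?P \<Longrightarrow> fst (h e) = fst e"
    unfolding trivial_bundle_def pullback_bundle_def associated_bundle_def gbundle.simps by blast
  obtain h' where h': "homeomorphic_maps ?P (prod_topology circle T) h h'"
    using h homeomorphic_map_maps by blast
  \<comment> \<open>As \<open>h'\<close> inverts the trivialization, \<open>s\<close> is the section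
    of the pullback that corresponds to the constant section at the identity.\<close>
  define s where "s = (\<lambda>z. h' (z, \<one>\<^bsub>G\<^esub>))"
  have "continuous_map circle (prod_topology circle T) (\<lambda>z. (z, \<one>\<^bsub>G\<^esub>))"
    by (simp add: continuous_map_paired)
  moreover have "continuous_map (prod_topology circle T) ?P h'"
    using h' by (simp add: homeomorphic_maps_def)
  ultimately have sP: "continuous_map circle ?P s"
    unfolding s_def using continuous_map_compose by (fastforce simp: o_def)
  then have s: "continuous_map circle (prod_topology circle E) s"
    by (rule continuous_map_into_fulltopology)
  have s_in: "s z \<in> topspace ?P" if "z \<in> topspace circle" for z
    using continuous_map_image_subset_topspace[OF sP] that by blast
  \<comment> \<open>The trivialization preserves the circle coordinate, hence so does its inverse;
    the pullback condition then places the second coordinate of \<open>s z\<close> over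
    \<open>l z\<close>.\<close>
  have "fst (s z) = z" if "z \<in> topspace circle" for z
    using h' h_fst[OF s_in[OF that]] that by (simp add: homeomorphic_maps_def s_def)
  then have "fst ` (snd \<circ> s) z = l z" if "z \<in> topspace circle" for z
    using s_in[OF that] that by (simp add: case_prod_unfold)
  moreover have "continuous_map circle E (snd \<circ> s)"
    using s continuous_map_snd by (rule continuous_map_compose)
  ultimately obtain k where k: "continuous_map circle X k"
      "\<And>z. z \<in> topspace circle \<Longrightarrow> orbit \<Gamma> act (k z) = l z"
    using section_over_loop_lifts[OF inj] by metis
  then obtain c where "homotopic_with (\<lambda>_. True) circle X k (\<lambda>_. c)"
    using sc unfolding simply_connected_space_def nullhomotopic_loop_def by blast
  then have "homotopic_with (\<lambda>_. True) circle Y (orbit \<Gamma> act \<circ> k) (orbit \<Gamma> act \<circ> (\<lambda>_. c))"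
    by (rule homotopic_with_compose_continuous_map_left[OF _ base.continuous_map_orbit]) simp
  \<comment> \<open>The maps \<open>orbit \<Gamma> act \<circ> k\<close> and \<open>l\<close> are
    known to agree only on the circle, which is enough for \<open>homotopic_with_eq\<close>.\<close>
  then have "homotopic_with (\<lambda>_. True) circle Y l (\<lambda>_. orbit \<Gamma> act c)"
    by (rule homotopic_with_eq) (simp_all add: k)
  then show False
    using nl by (auto simp: nullhomotopic_loop_def)
qed

end

theorem lemma1p11:
  fixes X :: "'a topology"
    and G :: "'g monoid" and T :: "'g topology"
    and \<Gamma> :: "'c monoid" and act :: "'c \<Rightarrow> 'a \<Rightarrow> 'a"
    and \<phi> :: "'c \<Rightarrow> 'g"
  assumes "simply_connected_space X" and "locally_path_connected_space X" and "Hausdorff_space X"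
    and "topological_group G T" and "compact_space T" and "Hausdorff_space T"
    and "group \<Gamma>"
    and "continuous_action \<Gamma> X act" and "free_action \<Gamma> X act"
    and "properly_discontinuous \<Gamma> X act"
    and "\<phi> \<in> hom \<Gamma> G"
    and "(\<lambda>\<gamma>. identity_path_component G T #>\<^bsub>G\<^esub> \<phi> \<gamma>) \<in> mon \<Gamma> (G Mod identity_path_component G T)"
  shows "incompressible G T (associated_bundle \<Gamma> X act G T \<phi>)"
proof -
  interpret flat: flat_bundle \<Gamma> X act G T \<phi>
    using assms by unfold_locales
  \<comment> \<open>Unfolding \<open>mon\<close> yields the injectivity on
    \<open>carrier \<Gamma>\<close> that \<open>flat.incompressible\<close> asks for.\<close>
  show ?thesis
    using assms by (intro flat.incompressible) (auto simp: mon_def)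
qed

end
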